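(* Let $C\ge 2$ and let $\pi_i^L\le\pi_i^U$, $\tau_i^L\le\tau_i^U$, $\alpha_i^L\le\alpha_i^U$ ($i=1,\dots,C-1$) be the lower and upper bounds for cumulative probabilities described in the context. Let $$L=\min_{\pi,\tau,\alpha}\left(\max_{i=1,\dots,C-1}|\pi_i-\alpha_i|-\max_{i=1,\dots,C-1}|\tau_i-\alpha_i|\right),$$ where the minimum is over all cumulative distributions $\pi,\tau,\alpha$ with $\pi_i^L\le\pi_i\le\pi_i^U$, $\tau_i^L\le\tau_i\le\tau_i^U$, $\alpha_i^L\le\alpha_i\le\alpha_i^U$, $i=1,\dots,C-1$; that is, $L$ is the lower bound for $D_{KS}(P,Q)-D_{KS}(R,Q)$. Then $L$ is determined by solving the following $2(C-1)$ linear programming problems: $$L_1(k)=\min_{B,\pi,\alpha}\left(B-\tau_k^U+\alpha_k\right),\qquad L_2(k)=\min_{B,\pi,\alpha}\left(B-\alpha_k+\tau_k^L\right),\qquad k=1,\dots,C-1,$$ all subject to $$\pi_i^L\le\pi_i\le\pi_i^U,\quad \alpha_i^L\le\alpha_i\le\alpha_i^U,\quad i=1,\dots,C-1,$$ $$B\ge\pi_i-\alpha_i,\quad B\ge\alpha_i-\pi_i,\quad i=1,\dots,C-1,$$ $$\pi_i\le\pi_{i+1},\quad \alpha_i\le\alpha_{i+1},\quad i=1,\dots,C-2,$$ where for $L_1(k)$ the following constraints are added: $$\alpha_k\le\tau_k^U\quad\text{and}\quad \tau_k^U-\alpha_k\ge\tau_i^U-\alpha_i,\quad i=1,\dots,C-1,\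 i\ne k,$$ and for $L_2(k)$ the following constraints are added: $$\alpha_k\ge\tau_k^L\quad\text{and}\quad \alpha_k-\tau_k^L\ge\alpha_i-\tau_i^L,\quad i=1,\dots,C-1,\ i\ne k.$$ The final solution is determined by selecting $k_1=\arg\max_k(\tau_k^U-\alpha_k)$ from the problems $L_1(k)$ and $k_2=\arg\max_k(\alpha_k-\tau_k^L)$ from the problems $L_2(k)$, where in each case $\alpha_k$ is the value at the optimal solution of the $k$-th problem, and $$L=\begin{cases}L_1(k_1), & \text{if } \tau_{k_1}^U-\alpha_{k_1}\ge\alpha_{k_2}-\tau_{k_2}^L,\\ L_2(k_2), & \text{otherwise.}\end{cases}$$
   Context: For probability distributions $P=(p_1,\dots,p_C)$ and $Q=(q_1,\dots,q_C)$ on $C$ classes with cumulative distributions $\pi_i=\sum_{j\le i}p_j$, $\alpha_i=\sum_{j\le i}q_j$ (so $\pi_C=\alpha_C=1$), the Kolmogorov-Smirnov distance is $D_{KS}(P,Q)=\max_{i=1,\dots,C-1}|\pi_i-\alpha_i|$. Cumulative distributions are nondecreasing in $i$, with last entry (index $C$) equal to $1$. Three fixed probability distributions $P_S,P_{S,i},P_N$ on $C$ classes and a number $\varepsilon\in[0,1]$ are given. The imprecise $\varepsilon$-contamination model replaces a distribution $P$ by the set of distributions $P^*=(1-\varepsilon)P+\varepsilon H$, with $H$ an arbitrary distribution, so that the probability of an event $A$ is bounded by $(1-\varepsilon)P(A)\le P^*(A)\le(1-\varepsilon)P(A)+\varepsilon$. Taking $A=\{1,\dots,i\}$ gives bounds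 for the $i$-th cumulative probability. The letters $\pi$ (for $P$), $\tau$ (for $R$), $\alpha$ (for $Q$) denote cumulative distributions in the sets produced by the model from $P_S$, $P_{S,i}$, $P_N$ respectively, and $[\pi_i^L,\pi_i^U]$, $[\tau_i^L,\tau_i^U]$, $[\alpha_i^L,\alpha_i^U]$ are the corresponding bounds; e.g. $\pi_i^L=(1-\varepsilon)P_S(\{1,\dots,i\})$, $\pi_i^U=(1-\varepsilon)P_S(\{1,\dots,i\})+\varepsilon$. Some of the linear programs may have no solution: $L_1(k)$ when $\tau_k^U<\alpha_k^L$, and $L_2(k)$ when $\tau_k^L>\alpha_k^U$; such problems are disregarded in the selection.
   Formalization: Optimal solutions of the programs need not be unique, and for some choices the selection rule returns a wrong value; the formal statement says that optimal solutions exist for which the rule, with any choice of k_1 and k_2, gives L (if one family has no solvable program, the other is used). *)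

theory Defs
  imports "HOL-Probability.Probability_Mass_Function"
begin

text \<open>Classes are numbered \<open>1, \<dots>, C\<close>; a distribution on them is a \<open>nat pmf\<close> supported in \<open>{1..C}\<close>.
  Cumulative distributions are functions \<open>nat \<Rightarrow> real\<close> of which only the values on \<open>{1..C}\<close>
  matter.\<close>

definition dist_on_classes :: "nat \<Rightarrow> nat pmf \<Rightarrow> bool" where
  "dist_on_classes C P \<longleftrightarrow> set_pmf P \<subseteq> {1..C}"

definition cumulative :: "nat \<Rightarrow> (nat \<Rightarrow> real) \<Rightarrow> bool" where
  "cumulative C F \<longleftrightarrow> 0 \<le> F 1 \<and> mono_on {1..C} F \<and> F C = 1"

definition D_KS :: "nat \<Rightarrow> (nat \<Rightarrow> real) \<Rightarrow> (nat \<Rightarrow> real) \<Rightarrow> real" where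
  "D_KS C F G = (MAX i\<in>{1..C-1}. \<bar>F i - G i\<bar>)"

definition lower_cum :: "real \<Rightarrow> nat pmf \<Rightarrow> nat \<Rightarrow> real" where
  "lower_cum \<epsilon> P i = (1 - \<epsilon>) * measure_pmf.prob P {1..i}"

definition upper_cum :: "real \<Rightarrow> nat pmf \<Rightarrow> nat \<Rightarrow> real" where
  "upper_cum \<epsilon> P i = (1 - \<epsilon>) * measure_pmf.prob P {1..i} + \<epsilon>"

definition in_bounds :: "nat \<Rightarrow> (nat \<Rightarrow> real) \<Rightarrow> (nat \<Rightarrow> real) \<Rightarrow> (nat \<Rightarrow> real) \<Rightarrow> bool" where
  "in_bounds C lo up F \<longleftrightarrow> (\<forall>i\<in>{1..C-1}. lo i \<le> F i \<and> F i \<le> up i)"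

fun KS_diff :: "nat \<Rightarrow> (nat \<Rightarrow> real) \<times> (nat \<Rightarrow> real) \<times> (nat \<Rightarrow> real) \<Rightarrow> real" where
  "KS_diff C (\<pi>, \<tau>, \<alpha>) = D_KS C \<pi> \<alpha> - D_KS C \<tau> \<alpha>"

fun KS_feasible :: "nat \<Rightarrow> (nat \<Rightarrow> real) \<Rightarrow> (nat \<Rightarrow> real) \<Rightarrow> (nat \<Rightarrow> real) \<Rightarrow> (nat \<Rightarrow> real) \<Rightarrow>
    (nat \<Rightarrow> real) \<Rightarrow> (nat \<Rightarrow> real) \<Rightarrow> (nat \<Rightarrow> real) \<times> (nat \<Rightarrow> real) \<times> (nat \<Rightarrow> real) \<Rightarrow> bool" where
  "KS_feasible C \<pi>L \<pi>U \<tau>L \<tau>U \<alpha>L \<alpha>U (\<pi>, \<tau>, \<alpha>) \<longleftrightarrow>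
     cumulative C \<pi> \<and> cumulative C \<tau> \<and> cumulative C \<alpha> \<and>
     in_bounds C \<pi>L \<pi>U \<pi> \<and> in_bounds C \<tau>L \<tau>U \<tau> \<and> in_bounds C \<alpha>L \<alpha>U \<alpha>"

text \<open>The linear programs have the variables \<open>B\<close>, \<open>\<pi> i\<close> and \<open>\<alpha> i\<close> with \<open>i \<in> {1..C-1}\<close>.\<close>

type_synonym lp_point = "real \<times> (nat \<Rightarrow> real) \<times> (nat \<Rightarrow> real)"

fun common_constraints :: "nat \<Rightarrow> (nat \<Rightarrow> real) \<Rightarrow> (nat \<Rightarrow> real) \<Rightarrow> (nat \<Rightarrow> real) \<Rightarrow> (nat \<Rightarrow> real) \<Rightarrow>
    lp_point \<Rightarrow> bool" where
  "common_constraints C \<pi>L \<pi>U \<alpha>L \<alpha>U (B, \<pi>, \<alpha>) \<longleftrightarrow>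
     in_bounds C \<pi>L \<pi>U \<pi> \<and> in_bounds C \<alpha>L \<alpha>U \<alpha> \<and>
     (\<forall>i\<in>{1..C-1}. B \<ge> \<pi> i - \<alpha> i \<and> B \<ge> \<alpha> i - \<pi> i) \<and>
     (\<forall>i\<in>{1..C-2}. \<pi> i \<le> \<pi> (i+1) \<and> \<alpha> i \<le> \<alpha> (i+1))"

fun L1_feasible :: "nat \<Rightarrow> (nat \<Rightarrow> real) \<Rightarrow> (nat \<Rightarrow> real) \<Rightarrow> (nat \<Rightarrow> real) \<Rightarrow> (nat \<Rightarrow> real) \<Rightarrow>
    (nat \<Rightarrow> real) \<Rightarrow> nat \<Rightarrow> lp_point \<Rightarrow> bool" where
  "L1_feasible C \<pi>L \<pi>U \<tau>U \<alpha>L \<alpha>U k (B, \<pi>, \<alpha>) \<longleftrightarrow>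
     common_constraints C \<pi>L \<pi>U \<alpha>L \<alpha>U (B, \<pi>, \<alpha>) \<and>
     \<alpha> k \<le> \<tau>U k \<and> (\<forall>i\<in>{1..C-1} - {k}. \<tau>U k - \<alpha> k \<ge> \<tau>U i - \<alpha> i)"

fun L2_feasible :: "nat \<Rightarrow> (nat \<Rightarrow> real) \<Rightarrow> (nat \<Rightarrow> real) \<Rightarrow> (nat \<Rightarrow> real) \<Rightarrow> (nat \<Rightarrow> real) \<Rightarrow>
    (nat \<Rightarrow> real) \<Rightarrow> nat \<Rightarrow> lp_point \<Rightarrow> bool" where
  "L2_feasible C \<pi>L \<pi>U \<tau>L \<alpha>L \<alpha>U k (B, \<pi>, \<alpha>) \<longleftrightarrow>
     common_constraints C \<pi>L \<pi>U \<alpha>L \<alpha>U (B, \<pi>, \<alpha>) \<and>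
     \<alpha> k \<ge> \<tau>L k \<and> (\<forall>i\<in>{1..C-1} - {k}. \<alpha> k - \<tau>L k \<ge> \<alpha> i - \<tau>L i)"

fun L1_obj :: "(nat \<Rightarrow> real) \<Rightarrow> nat \<Rightarrow> lp_point \<Rightarrow> real" where
  "L1_obj \<tau>U k (B, \<pi>, \<alpha>) = B - \<tau>U k + \<alpha> k"

fun L2_obj :: "(nat \<Rightarrow> real) \<Rightarrow> nat \<Rightarrow> lp_point \<Rightarrow> real" where
  "L2_obj \<tau>L k (B, \<pi>, \<alpha>) = B - \<alpha> k + \<tau>L k"

text \<open>\<open>K1\<close>, \<open>K2\<close> are the indices of the solvable programs of the two families, \<open>v1 k\<close>, \<open>v2 k\<close>
  their optimal values and \<open>d1 k\<close>, \<open>d2 k\<close> the quantities whose maximisers \<open>k1\<close>, \<open>k2\<close> are selected.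
  The predicate says that at least one program is solvable and that the selection rule yields \<open>L\<close>,
  for every choice of the maximisers. If one of the families has no solvable program, the other
  family is used.\<close>

definition selection_yields :: "nat set \<Rightarrow> (nat \<Rightarrow> real) \<Rightarrow> (nat \<Rightarrow> real) \<Rightarrow>
    nat set \<Rightarrow> (nat \<Rightarrow> real) \<Rightarrow> (nat \<Rightarrow> real) \<Rightarrow> real \<Rightarrow> bool" where
  "selection_yields K1 d1 v1 K2 d2 v2 L \<longleftrightarrow>
     K1 \<union> K2 \<noteq> {} \<and>
     (\<forall>k1 k2.
        (K1 \<noteq> {} \<longrightarrow> is_arg_max d1 (\<lambda>k. k \<in> K1) k1) \<longrightarrow>
        (K2 \<noteq> {} \<longrightarrow> is_arg_max d2 (\<lambda>k. k \<in> K2) k2) \<longrightarrow>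
        L = (if K2 = {} \<or> (K1 \<noteq> {} \<and> d1 k1 \<ge> d2 k2) then v1 k1 else v2 k2))"

end

theory Submission
  imports Defs
begin

text \<open>Each lower cumulative probability \<open>f\<close> comes with the band \<open>[f, f + \<epsilon>]\<close>; write \<open>a, p, t\<close> for the
  lower bounds of \<open>\<alpha>, \<pi>, \<tau>\<close>. Projected to \<open>B\<close> and the deviation \<open>d = t k + \<epsilon> - \<alpha> k\<close>, the program
  \<open>L\<^sub>1(k)\<close> is two-dimensional: \<open>d\<close> ranges over
  \<open>W \<le> d \<le> D k\<close> with \<open>W = max 0 (max\<^sub>i (t i - a i))\<close> (\<open>excess\<close>) and \<open>D k = t k - a k + \<epsilon>\<close> (\<open>dist_max\<close>), and the
  only constraint on \<open>B\<close> is \<open>B \<ge> max G (max (p k - t k - \<epsilon> + d) (M - d))\<close> with constants \<open>G\<close> (\<open>gap\<close>) and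
  \<open>M\<close> (\<open>shift\<close>) independent of \<open>k\<close>.
  Hence \<open>d = D k\<close> is always optimal, and the optimal values of \<open>d\<close> form an interval whose left end is
  \<open>max W (max (G - v) ((M - v) / 2))\<close>, \<open>v\<close> being the value of the program. The programs \<open>L\<^sub>2(k)\<close> are the programs
  \<open>L\<^sub>1(k)\<close> for the negated bands and the reversed order of the classes.

  \<open>L\<close> is the least value of all programs. In the programs attaining it choose the optimum with the
  largest \<open>d\<close>, in all others the one with the smallest \<open>d\<close>. Within a family the left end
  decreases with the value; this and a comparison of the constants of the two families show that every
  non-optimal program is strictly beaten in \<open>d\<close> by some optimal one, so the selected maximiser is optimal.\<close>

section \<open>Constants of the projected programs\<close>

text \<open>Negation sends the band \<open>[f, f + e]\<close> to \<open>[- (f + e), - f]\<close>,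
  again of width \<open>e\<close>; this is the lower end of the negated band.\<close>

definition reflect :: "real \<Rightarrow> ('i \<Rightarrow> real) \<Rightarrow> 'i \<Rightarrow> real" where
  "reflect e f i = - (f i + e)"

lemma reflect_reflect [simp]: "reflect e (reflect e f) = f"
  by (auto simp: reflect_def)

text \<open>Disjoint bands of width \<open>e\<close> with lower ends \<open>p i\<close> and
  \<open>a i\<close> lie \<open>\<bar>p i - a i\<bar> - e\<close> apart, and every feasible
  \<open>B\<close> has to cover this separation. The inserted 0 accounts for
  \<open>B \<ge> 0\<close> when all bands overlap.\<close>

definition gap :: "'i set \<Rightarrow> ('i \<Rightarrow> real) \<Rightarrow> ('i \<Rightarrow> real) \<Rightarrow> real \<Rightarrow> real" where
  "gap I a p e = Max (insert 0 ((\<lambda>i. \<bar>p i - a i\<bar> - e) ` I))"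

text \<open>A lower bound for the deviation \<open>d\<close>: maximality of \<open>k\<close> gives
  \<open>t i + e - \<alpha> i \<le> d\<close>, while \<open>\<alpha> i \<le> a i + e\<close>. The 0
  comes from \<open>\<alpha> k \<le> t k + e\<close>.\<close>

definition excess :: "'i set \<Rightarrow> ('i \<Rightarrow> real) \<Rightarrow> ('i \<Rightarrow> real) \<Rightarrow> real" where
  "excess I a t = Max (insert 0 ((\<lambda>i. t i - a i) ` I))"

definition shift :: "'i set \<Rightarrow> ('i \<Rightarrow> real) \<Rightarrow> ('i \<Rightarrow> real) \<Rightarrow> real" where
  "shift I p t = Max ((\<lambda>i. t i - p i) ` I)"

definition dist_max :: "('i \<Rightarrow> real) \<Rightarrow> ('i \<Rightarrow> real) \<Rightarrow> real \<Rightarrow> 'i \<Rightarrow> real" where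
  "dist_max a t e k = t k - a k + e"

text \<open>With \<open>\<alpha> k = t k + e - d\<close>, the term in \<open>p k\<close> comes from
  \<open>\<pi> k \<ge> p k\<close>. The last term comes from
  \<open>\<alpha> i \<ge> t i + e - d\<close> and \<open>\<pi> i \<le> p i + e\<close> at an index
  \<open>i\<close> attaining \<open>shift\<close>.\<close>

definition B_min :: "'i set \<Rightarrow> ('i \<Rightarrow> real) \<Rightarrow> ('i \<Rightarrow> real) \<Rightarrow> ('i \<Rightarrow> real) \<Rightarrow> real \<Rightarrow> 'i \<Rightarrow> real \<Rightarrow> real" where
  "B_min I a p t e k d = max (gap I a p e) (max (p k - t k - e + d) (shift I p t - d))"

definition lp_value :: "'i set \<Rightarrow> ('i \<Rightarrow> real) \<Rightarrow> ('i \<Rightarrow> real) \<Rightarrow> ('i \<Rightarrow> real) \<Rightarrow> real \<Rightarrow> 'i \<Rightarrow> real" where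
  "lp_value I a p t e k = B_min I a p t e k (dist_max a t e k) - dist_max a t e k"

text \<open>Solves \<open>B_min I a p t e k d - d \<le> lp_value I a p t e k\<close> for
  \<open>d\<close>, term by term. In the \<open>shift\<close> term \<open>d\<close> is subtracted
  twice, hence the factor 1/2; in the term with \<open>p k\<close> it cancels, so that term puts no
  condition on \<open>d\<close>.\<close>

definition dist_min :: "'i set \<Rightarrow> ('i \<Rightarrow> real) \<Rightarrow> ('i \<Rightarrow> real) \<Rightarrow> ('i \<Rightarrow> real) \<Rightarrow> real \<Rightarrow> 'i \<Rightarrow> real" where
  "dist_min I a p t e k =
     max (excess I a t) (max (gap I a p e - lp_value I a p t e k) ((shift I p t - lp_value I a p t e k) / 2))"

definition solvable :: "'i set \<Rightarrow> ('i \<Rightarrow> real) \<Rightarrow> ('i \<Rightarrow> real) \<Rightarrow> real \<Rightarrow> 'i set" where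
  "solvable I a t e = {k \<in> I. excess I a t \<le> dist_max a t e k}"

lemma gap_ge:
  assumes "finite I"
  shows "0 \<le> gap I a p e" and "i \<in> I \<Longrightarrow> p i - a i - e \<le> gap I a p e"
    and "i \<in> I \<Longrightarrow> a i - p i - e \<le> gap I a p e"
proof -
  show "0 \<le> gap I a p e"
    unfolding gap_def using assms by (intro Max_ge) auto
  assume "i \<in> I"
  then have "\<bar>p i - a i\<bar> - e \<le> gap I a p e"
    unfolding gap_def using assms by (intro Max_ge) auto
  then show "p i - a i - e \<le> gap I a p e" "a i - p i - e \<le> gap I a p e"
    by auto
qed

lemma gap_le:
  assumes "finite I" "0 \<le> B" "\<And>i. i \<in> I \<Longrightarrow> \<bar>p i - a i\<bar> - e \<le> B"
  shows "gap I a p e \<le> B"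
  unfolding gap_def using assms by (subst Max_le_iff) auto

lemma excess_ge:
  assumes "finite I"
  shows "0 \<le> excess I a t" and "i \<in> I \<Longrightarrow> t i - a i \<le> excess I a t"
  unfolding excess_def using assms by (auto intro!: Max_ge)

lemma excess_le:
  assumes "finite I" "0 \<le> d" "\<And>i. i \<in> I \<Longrightarrow> t i - a i \<le> d"
  shows "excess I a t \<le> d"
  unfolding excess_def using assms by (subst Max_le_iff) auto

lemma excess_cases:
  assumes "finite I"
  obtains "excess I a t = 0" | j where "j \<in> I" "excess I a t = t j - a j"
proof -
  have "excess I a t \<in> insert 0 ((\<lambda>i. t i - a i) ` I)"
    unfolding excess_def using assms by (intro Max_in) auto
  then show ?thesis using that by auto
qed

lemma shift_ge: "finite I \<Longrightarrow> i \<in> I \<Longrightarrow> t i - p i \<le> shift I p t"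
  unfolding shift_def by (intro Max_ge) auto

lemma shift_obtain:
  assumes "finite I" "I \<noteq> {}"
  obtains j where "j \<in> I" "shift I p t = t j - p j"
proof -
  have "shift I p t \<in> (\<lambda>i. t i - p i) ` I"
    unfolding shift_def using assms by (intro Max_in) auto
  then show ?thesis using that by auto
qed

lemma gap_reflect [simp]: "gap I (reflect e a) (reflect e p) e = gap I a p e"
proof -
  have "\<bar>reflect e p i - reflect e a i\<bar> = \<bar>p i - a i\<bar>" for i
    by (auto simp: reflect_def)
  then show ?thesis by (simp add: gap_def)
qed

lemma dist_max_reflect: "dist_max (reflect e a) (reflect e t) e k = a k - t k + e"
  by (simp add: dist_max_def reflect_def)

lemma lp_value_eq:
  "lp_value I a p t e k =
     max (gap I a p e - dist_max a t e k) (max (p k - t k - e) (shift I p t - 2 * dist_max a t e k))"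
  unfolding lp_value_def B_min_def by (auto simp: max_def)

lemma lp_value_ge:
  "gap I a p e - dist_max a t e k \<le> lp_value I a p t e k"
  "p k - t k - e \<le> lp_value I a p t e k"
  "shift I p t - 2 * dist_max a t e k \<le> lp_value I a p t e k"
  unfolding lp_value_eq by auto

lemma lp_value_le:
  assumes "gap I a p e - dist_max a t e k \<le> v" "p k - t k - e \<le> v"
    "shift I p t - 2 * dist_max a t e k \<le> v"
  shows "lp_value I a p t e k \<le> v"
  unfolding lp_value_eq using assms by auto

lemma dist_min_le_dist_max:
  assumes "k \<in> solvable I a t e"
  shows "dist_min I a p t e k \<le> dist_max a t e k"
  using assms lp_value_ge[where I = I and a = a and p = p and t = t and e = e and k = k] unfolding dist_min_def solvable_def by auto

lemma mem_solvable_iff: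
  assumes "finite I"
  shows "k \<in> solvable I a t e \<longleftrightarrow> k \<in> I \<and> 0 \<le> dist_max a t e k \<and> (\<forall>i\<in>I. t i - a i \<le> dist_max a t e k)"
  unfolding solvable_def excess_def using assms by (auto simp: Max_le_iff)

section \<open>Deviations of optimal and non-optimal programs compared\<close>

text \<open>When \<open>m\<close> itself does not work, its deviation interval is the single point \<open>W\<close>. Then either the index
  attaining the maximum in \<open>W\<close> is a better optimal program, or \<open>W = 0\<close> and the least \<open>t j - a j\<close> gives an
  optimal program of the other family.\<close>

lemma optimal_dist_same:
  fixes a p t :: "'i \<Rightarrow> real"
  assumes I: "finite I" "I \<noteq> {}" and e: "0 \<le> e"
    and le1: "\<And>j. j \<in> solvable I a t e \<Longrightarrow> L \<le> lp_value I a p t e j"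
    and le2: "\<And>j. j \<in> solvable I (reflect e a) (reflect e t) e \<Longrightarrow>
                L \<le> lp_value I (reflect e a) (reflect e p) (reflect e t) e j"
    and m: "m \<in> solvable I a t e" "lp_value I a p t e m = L"
    and k: "k \<in> solvable I a t e" "L < lp_value I a p t e k"
  shows "(\<exists>x\<in>solvable I a t e. lp_value I a p t e x = L \<and> dist_min I a p t e k < dist_max a t e x) \<or>
    (\<exists>x\<in>solvable I (reflect e a) (reflect e t) e.
       lp_value I (reflect e a) (reflect e p) (reflect e t) e x = L \<and>
       dist_min I a p t e k < dist_max (reflect e a) (reflect e t) e x)"
proof -
  note g = gap_ge[OF I(1), where a = a and p = p and e = e]
  note x = excess_ge[OF I(1), where a = a and t = t]
  note vm = lp_value_ge[where I = I and a = a and p = p and t = t and e = e and k = m]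
  have mI: "m \<in> I" "excess I a t \<le> dist_max a t e m" and kI: "k \<in> I" "excess I a t \<le> dist_max a t e k"
    using m k by (auto simp: solvable_def)
  \<comment> \<open>Optimality of \<open>m\<close> bounds \<open>gap - L\<close> and
    \<open>(shift - L) / 2\<close> by the deviation of \<open>m\<close>. The larger value of
    \<open>k\<close> in place of \<open>L\<close> makes both bounds strict.\<close>
  have less: "dist_min I a p t e k < d" if "excess I a t < d" "dist_max a t e m \<le> d" for d
    using that vm m k unfolding dist_min_def by auto
  show ?thesis
  proof (cases "excess I a t < dist_max a t e m")
    case True
    then show ?thesis using less m by blast
  next
    case False
    then have W: "excess I a t = dist_max a t e m" using mI by simp
    \<comment> \<open>For \<open>e = 0\<close> the deviation of \<open>k\<close> is
      \<open>t k - a k\<close>, which is squeezed to \<open>excess\<close>, the deviation of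
      \<open>m\<close>. Then \<open>p k - t k\<close> is at most \<open>gap\<close> minus this
      deviation, so \<open>k\<close> would be as good as \<open>m\<close>.\<close>
    have e0: "e > 0"
    proof (rule ccontr)
      assume "\<not> e > 0"
      then have "e = 0" using e by simp
      then have "lp_value I a p t e k \<le> lp_value I a p t e m"
        using vm W kI(2) x(2)[OF kI(1)] g(2)[OF kI(1)]
        by (intro lp_value_le) (auto simp: dist_max_def)
      then show False using m k by simp
    qed
    show ?thesis
    proof (cases rule: excess_cases[OF I(1), of a t])
      case (2 j)
      then have "dist_max a t e j = excess I a t + e" by (simp add: dist_max_def)
      \<comment> \<open>The deviation only grows from \<open>m\<close> to \<open>j\<close>, and
        \<open>p j - t j - e = (p j - a j - e) - excess\<close> is at most \<open>gap\<close> minus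
        the deviation of \<open>m\<close>.\<close>
      moreover have "lp_value I a p t e j \<le> lp_value I a p t e m"
        using vm W 2 e calculation g(2)[OF 2(1)] by (intro lp_value_le) auto
      moreover have "j \<in> solvable I a t e"
        using 2 calculation(1) e by (auto simp: solvable_def)
      ultimately show ?thesis
        using less[of "dist_max a t e j"] le1[of j] e0 m W by (intro disjI1 bexI[of _ j]) auto
    next
      case 1
      obtain j where j: "j \<in> I" "\<And>i. i \<in> I \<Longrightarrow> t j - a j \<le> t i - a i"
        using arg_min_if_finite[OF I, of "\<lambda>i. t i - a i"]
        by (metis not_le)
      \<comment> \<open>The deviation of \<open>m\<close> is 0 here: the upper end of the \<tau>
        band touches the lower end of the \<alpha> band. Hence the least \<open>t j - a j\<close> is
        at most \<open>- e\<close>, and the reflected program at \<open>j\<close> has deviation at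
        least \<open>2 * e\<close>.\<close>
      have tm: "t m - a m = - e" using 1 W by (simp add: dist_max_def)
      let ?D = "dist_max (reflect e a) (reflect e t) e j"
      have D: "?D = a j - t j + e" by (rule dist_max_reflect)
      have De: "?D \<ge> 2 * e" using D tm j(2)[OF mI(1)] by simp
      have "j \<in> solvable I (reflect e a) (reflect e t) e"
        unfolding mem_solvable_iff[OF I(1)] using j De e D by (auto simp: reflect_def) (smt (verit) j)
      moreover have "lp_value I (reflect e a) (reflect e p) (reflect e t) e j \<le> L"
      proof (rule lp_value_le)
        show "gap I (reflect e a) (reflect e p) e - ?D \<le> L"
          using vm(1) W 1 m De e by simp
        show "reflect e p j - reflect e t j - e \<le> L"
          using vm(3) W 1 m shift_ge[OF I(1) j(1), of t p] e by (simp add: reflect_def)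
        \<comment> \<open>Here \<open>p i - t i = (p i - a i) + (a i - t i)\<close> is at most
          \<open>(gap + e) + (?D - e)\<close>, so subtracting \<open>2 * ?D\<close> leaves at most
          \<open>gap - ?D\<close>.\<close>
        obtain i where i: "i \<in> I" "shift I (reflect e p) (reflect e t) = p i - t i"
          by (rule shift_obtain[OF I, of "reflect e p" "reflect e t"]) (auto simp: reflect_def)
        show "shift I (reflect e p) (reflect e t) - 2 * ?D \<le> L"
          using vm(1) W 1 m g(2)[OF i(1)] i(2) j(2)[OF i(1)] D De e by simp
      qed
      ultimately show ?thesis
        using less[of ?D] le2[of j] De W 1 e0 by (intro disjI2 bexI[of _ j]) auto
    qed
  qed
qed

text \<open>By contradiction in both critical entries of \<open>dist_min\<close>. If
  \<open>excess\<close> reached the deviation of \<open>m\<close>, an index maximising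
  \<open>t i - a i\<close> would be a program of the first family with value at most
  \<open>L\<close>; if the \<open>shift\<close> entry reached it, an index attaining
  \<open>shift\<close> would be one.\<close>

lemma optimal_dist_cross:
  fixes a p t :: "'i \<Rightarrow> real"
  assumes I: "finite I" "I \<noteq> {}" and e: "0 \<le> e"
    and lt: "\<And>j. j \<in> solvable I a t e \<Longrightarrow> L < lp_value I a p t e j"
    and m: "m \<in> solvable I (reflect e a) (reflect e t) e"
      "lp_value I (reflect e a) (reflect e p) (reflect e t) e m = L"
    and k: "k \<in> solvable I a t e"
  shows "dist_min I a p t e k < dist_max (reflect e a) (reflect e t) e m"
proof -
  note g = gap_ge[OF I(1), where a = a and p = p and e = e]
  note x = excess_ge[OF I(1), where a = a and t = t]
  let ?D = "dist_max (reflect e a) (reflect e t) e m"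
  have D: "?D = a m - t m + e" by (rule dist_max_reflect)
  note vm = lp_value_ge[where I = I and a = "reflect e a" and p = "reflect e p" and t = "reflect e t" and e = e and k = m, unfolded m(2) gap_reflect]
  have mI: "m \<in> I" "?D \<ge> 0" using m(1) by (auto simp: mem_solvable_iff[OF I(1)])
  have W: "excess I a t < ?D"
  proof (rule ccontr)
    assume "\<not> excess I a t < ?D"
    moreover obtain j where j: "j \<in> I" "\<And>i. i \<in> I \<Longrightarrow> t i - a i \<le> t j - a j"
      using arg_min_if_finite[OF I, of "\<lambda>i. a i - t i"] by (smt (verit, best))
    ultimately have wj: "t j - a j \<ge> ?D" "t j - a j = excess I a t"
    proof -
      \<comment> \<open>In the second alternative \<open>?D\<close> must be 0, so
        \<open>t m - a m = e \<ge> 0\<close>; hence the maximum \<open>t j - a j\<close> is 0 as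
        well.\<close>
      have "excess I a t = t j - a j \<or> excess I a t = 0 \<and> t j - a j \<le> 0"
        by (rule excess_cases[OF I(1), of a t]) (use j x in force)+
      with \<open>\<not> excess I a t < ?D\<close> show "t j - a j \<ge> ?D" "t j - a j = excess I a t"
        using mI D e j(2)[OF mI(1)] by auto
    qed
    have Dj: "dist_max a t e j = t j - a j + e" by (simp add: dist_max_def)
    have "j \<in> solvable I a t e" using j wj e by (auto simp: solvable_def Dj)
    moreover have "lp_value I a p t e j \<le> L"
    proof (rule lp_value_le)
      show "gap I a p e - dist_max a t e j \<le> L" using vm(1) wj Dj e by simp
      show "p j - t j - e \<le> L" using vm(1) g(2)[OF j(1)] wj by simp
      obtain i where i: "i \<in> I" "shift I p t = t i - p i" by (rule shift_obtain[OF I])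
      show "shift I p t - 2 * dist_max a t e j \<le> L"
        using vm(1) g(3)[OF i(1)] i(2) j(2)[OF i(1)] wj Dj D e by simp
    qed
    ultimately show False using lt by fastforce
  qed
  have M: "shift I p t < lp_value I a p t e k + 2 * ?D"
  proof (rule ccontr)
    assume "\<not> ?thesis"
    then have s: "shift I p t > L + 2 * ?D" using lt[OF k] by simp
    obtain i where i: "i \<in> I" "shift I p t = t i - p i" by (rule shift_obtain[OF I])
    have Di: "dist_max a t e i = t i - a i + e" by (simp add: dist_max_def)
    \<comment> \<open>The separation bound gives \<open>dist_max a t e i \<ge> shift - gap\<close>;
      combine this with \<open>shift > L + 2 * ?D\<close> and
      \<open>gap \<le> L + ?D\<close>.\<close>
    have iD: "dist_max a t e i > ?D" using vm(1) g(3)[OF i(1)] s i Di by simp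
    have "i \<in> solvable I a t e" using i W iD by (auto simp: solvable_def)
    moreover have "lp_value I a p t e i \<le> L"
    proof (rule lp_value_le)
      show "gap I a p e - dist_max a t e i \<le> L" using vm(1) iD by simp
      show "p i - t i - e \<le> L" using s i vm(1) g(1) mI e by simp
      show "shift I p t - 2 * dist_max a t e i \<le> L"
        using vm(1) g(3)[OF i(1)] i(2) iD Di by simp
    qed
    ultimately show False using lt by fastforce
  qed
  show ?thesis
    using W M vm(1) lt[OF k] unfolding dist_min_def by (auto simp: field_simps)
qed

text \<open>The split is on whether the family of \<open>k\<close> itself contains an optimal
  program. Reflecting all bands exchanges the two families, so the statement also serves non-optimal
  programs of the second one.\<close>

lemma optimal_dist:
  fixes a p t :: "'i \<Rightarrow> real"
  assumes I: "finite I" "I \<noteq> {}" and e: "0 \<le> e"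
    and le1: "\<And>j. j \<in> solvable I a t e \<Longrightarrow> L \<le> lp_value I a p t e j"
    and le2: "\<And>j. j \<in> solvable I (reflect e a) (reflect e t) e \<Longrightarrow>
                L \<le> lp_value I (reflect e a) (reflect e p) (reflect e t) e j"
    and att: "(\<exists>m\<in>solvable I a t e. lp_value I a p t e m = L) \<or>
      (\<exists>m\<in>solvable I (reflect e a) (reflect e t) e.
         lp_value I (reflect e a) (reflect e p) (reflect e t) e m = L)"
    and k: "k \<in> solvable I a t e" "L < lp_value I a p t e k"
  shows "(\<exists>x\<in>solvable I a t e. lp_value I a p t e x = L \<and> dist_min I a p t e k < dist_max a t e x) \<or>
    (\<exists>x\<in>solvable I (reflect e a) (reflect e t) e.
       lp_value I (reflect e a) (reflect e p) (reflect e t) e x = L \<and>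
       dist_min I a p t e k < dist_max (reflect e a) (reflect e t) e x)"
proof (cases "\<exists>m\<in>solvable I a t e. lp_value I a p t e m = L")
  case True
  then obtain m where "m \<in> solvable I a t e" "lp_value I a p t e m = L" by blast
  from optimal_dist_same[OF I e le1 le2 this k] show ?thesis .
next
  case False
  then have lt: "L < lp_value I a p t e j" if "j \<in> solvable I a t e" for j
    using le1[OF that] that by force
  show ?thesis
    using optimal_dist_cross[OF I e lt _ _ k(1)] att False by blast
qed

section \<open>Projection of the linear programs to two dimensions\<close>

text \<open>A common form for both families: \<open>R\<close> is the order of the classes for the
  first and its converse, with negated bands, for the second. In the maximality constraint the
  common width \<open>e\<close> of the \<tau> bands has cancelled.\<close>

definition upper_lp :: "'i set \<Rightarrow> ('i \<Rightarrow> 'i \<Rightarrow> bool) \<Rightarrow> ('i \<Rightarrow> real) \<Rightarrow> ('i \<Rightarrow> real) \<Rightarrow> ('i \<Rightarrow> real) \<Rightarrow> real \<Rightarrow>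
    'i \<Rightarrow> real \<Rightarrow> ('i \<Rightarrow> real) \<Rightarrow> ('i \<Rightarrow> real) \<Rightarrow> bool" where
  "upper_lp I R a p t e k B \<pi> \<alpha> \<longleftrightarrow>
     (\<forall>i\<in>I. p i \<le> \<pi> i \<and> \<pi> i \<le> p i + e \<and> a i \<le> \<alpha> i \<and> \<alpha> i \<le> a i + e \<and> \<bar>\<pi> i - \<alpha> i\<bar> \<le> B) \<and>
     (\<forall>i\<in>I. \<forall>j\<in>I. R i j \<longrightarrow> \<pi> i \<le> \<pi> j \<and> \<alpha> i \<le> \<alpha> j) \<and>
     \<alpha> k \<le> t k + e \<and> (\<forall>i\<in>I. t i - \<alpha> i \<le> t k - \<alpha> k)"

text \<open>The necessity half of the projection; \<open>upper_lp_exists\<close> is the sufficiency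
  half.\<close>

lemma upper_lp_bounds:
  assumes "finite I" "I \<noteq> {}" "k \<in> I" and lp: "upper_lp I R a p t e k B \<pi> \<alpha>"
  defines "d \<equiv> t k + e - \<alpha> k"
  shows "excess I a t \<le> d" and "d \<le> dist_max a t e k" and "B_min I a p t e k d \<le> B"
proof -
  have b: "p i \<le> \<pi> i" "\<pi> i \<le> p i + e" "a i \<le> \<alpha> i" "\<alpha> i \<le> a i + e" "\<bar>\<pi> i - \<alpha> i\<bar> \<le> B"
    "t i + e - \<alpha> i \<le> d" if "i \<in> I" for i
    using lp that unfolding upper_lp_def d_def by force+
  have "0 \<le> d" using lp unfolding upper_lp_def d_def by simp
  then show "excess I a t \<le> d"
    by (intro excess_le) (use assms(1) b in \<open>force+\<close>)
  show "d \<le> dist_max a t e k" using b[OF assms(3)] by (simp add: d_def dist_max_def)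
  have "gap I a p e \<le> B"
    by (intro gap_le) (use assms(1,3) b in \<open>force+\<close>)
  moreover have "p k - t k - e + d \<le> B" using b[OF assms(3)] by (simp add: d_def)
  moreover obtain i where i: "i \<in> I" "shift I p t = t i - p i"
    by (rule shift_obtain[OF assms(1,2)])
  have "shift I p t - d \<le> B" using b[OF i(1)] i(2) by simp
  ultimately show "B_min I a p t e k d \<le> B" by (simp add: B_min_def)
qed

lemma upper_lp_exists:
  assumes I: "finite I" and k: "k \<in> I" and e: "0 \<le> e"
    and R: "reflp R" "transp R"
    and mono: "\<And>i j. i \<in> I \<Longrightarrow> j \<in> I \<Longrightarrow> R i j \<Longrightarrow> a i \<le> a j \<and> p i \<le> p j \<and> t i \<le> t j"
    and d: "excess I a t \<le> d" "d \<le> dist_max a t e k"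
  shows "\<exists>\<pi> \<alpha>. upper_lp I R a p t e k (B_min I a p t e k d) \<pi> \<alpha> \<and> t k + e - \<alpha> k = d"
proof -
  (* lo and hi are the pointwise bounds that d puts on \<alpha>; clamping p between them minimises |\<pi> - \<alpha>|
     everywhere, and p, lo and hi being monotone keeps the result monotone *)
  define lo where "lo i = max (a i) (t i + e - d)" for i
  define hi where "hi i = (if R i k then min (a i + e) (t k + e - d) else a i + e)" for i
  define \<alpha> where "\<alpha> i = max (lo i) (min (hi i) (p i))" for i
  define \<pi> where "\<pi> i = max (p i) (min (p i + e) (\<alpha> i))" for i
  note g = gap_ge[OF I, where a = a and p = p and e = e]
  note x = excess_ge[OF I, where a = a and t = t]
  have tk: "a k \<le> t k + e - d" using d(2) by (simp add: dist_max_def)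
  have td: "t i - a i \<le> d" if "i \<in> I" for i using x(2)[OF that] d(1) by simp
  \<comment> \<open>Both bounds on \<open>d\<close> enter here. From \<open>d \<ge> excess\<close>,
    the value \<open>t i + e - d\<close> stays below \<open>a i + e\<close>; from
    \<open>d \<le> dist_max\<close>, the cap \<open>t k + e - d\<close> stays above
    \<open>a k\<close>, hence above \<open>a i\<close> when \<open>R i k\<close>.\<close>
  have lohi: "lo i \<le> hi i" if "i \<in> I" for i
    using mono[OF that k] tk td[OF that] e by (auto simp: lo_def hi_def)
  have "lo k = t k + e - d" "hi k = t k + e - d"
    using tk td[OF k] R(1) by (auto simp: lo_def hi_def reflp_def)
  then have \<alpha>k: "\<alpha> k = t k + e - d" by (simp add: \<alpha>_def)
  have lo_mono: "lo i \<le> lo j" if "i \<in> I" "j \<in> I" "R i j" for i j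
    using mono[OF that] by (auto simp: lo_def)
  have hi_mono: "hi i \<le> hi j" if "i \<in> I" "j \<in> I" "R i j" for i j
    using mono[OF that] transpD[OF R(2) that(3), of k] by (auto simp: hi_def)
  have \<alpha>_mono: "\<alpha> i \<le> \<alpha> j" if "i \<in> I" "j \<in> I" "R i j" for i j
    using mono[OF that] lo_mono[OF that] hi_mono[OF that] by (auto simp: \<alpha>_def)
  have \<pi>_mono: "\<pi> i \<le> \<pi> j" if "i \<in> I" "j \<in> I" "R i j" for i j
    using mono[OF that] \<alpha>_mono[OF that] by (auto simp: \<pi>_def)
  have \<alpha>_bounds: "lo i \<le> \<alpha> i" "\<alpha> i \<le> hi i" if "i \<in> I" for i
    using lohi[OF that] by (auto simp: \<alpha>_def)
  have hi_a: "hi i \<le> a i + e" for i by (auto simp: hi_def)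
  \<comment> \<open>The left side is the distance of \<open>\<alpha> i\<close> from the band of
    \<open>\<pi> i\<close>. As \<open>\<alpha> i\<close> is \<open>p i\<close> clamped to
    \<open>[lo i, hi i]\<close>, it can lie below the band only by \<open>p i - hi i\<close> and
    above it only by \<open>lo i - p i - e\<close>.\<close>
  have B: "\<bar>\<pi> i - \<alpha> i\<bar> \<le> B_min I a p t e k d" if i: "i \<in> I" for i
  proof -
    have "p i - hi i \<le> B_min I a p t e k d"
      using g(2)[OF i] mono[OF i k] by (auto simp: hi_def B_min_def)
    moreover have "lo i - p i - e \<le> B_min I a p t e k d"
      using g(3)[OF i] shift_ge[OF I i, of t p] by (auto simp: lo_def B_min_def)
    moreover have "0 \<le> B_min I a p t e k d" using g(1) by (auto simp: B_min_def)
    ultimately show ?thesis using lohi[OF i] e unfolding \<pi>_def \<alpha>_def by (smt (verit))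
  qed
  have "upper_lp I R a p t e k (B_min I a p t e k d) \<pi> \<alpha>"
    unfolding upper_lp_def
  proof (intro conjI ballI impI)
    fix i assume i: "i \<in> I"
    show "p i \<le> \<pi> i" "\<pi> i \<le> p i + e" using e by (auto simp: \<pi>_def)
    show "a i \<le> \<alpha> i" "\<alpha> i \<le> a i + e" "t i - \<alpha> i \<le> t k - \<alpha> k"
      using \<alpha>_bounds[OF i] hi_a[of i] \<alpha>k by (auto simp: lo_def)
    show "\<bar>\<pi> i - \<alpha> i\<bar> \<le> B_min I a p t e k d" using B i .
  next
    show "\<alpha> k \<le> t k + e" using \<alpha>k d(1) x(1) by simp
  qed (use \<pi>_mono \<alpha>_mono in auto)
  then show ?thesis using \<alpha>k by (intro exI[of _ \<pi>] exI[of _ \<alpha>]) simp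
qed

lemma upper_lp_solvable_iff:
  assumes "finite I" "0 \<le> e" "reflp R" "transp R"
    and "\<And>i j. i \<in> I \<Longrightarrow> j \<in> I \<Longrightarrow> R i j \<Longrightarrow> a i \<le> a j \<and> p i \<le> p j \<and> t i \<le> t j"
  shows "k \<in> solvable I a t e \<longleftrightarrow> k \<in> I \<and> (\<exists>B \<pi> \<alpha>. upper_lp I R a p t e k B \<pi> \<alpha>)"
proof
  assume "k \<in> solvable I a t e"
  then show "k \<in> I \<and> (\<exists>B \<pi> \<alpha>. upper_lp I R a p t e k B \<pi> \<alpha>)"
    using upper_lp_exists[OF assms(1) _ assms(2-), where k = k and d = "dist_max a t e k"]
    by (fastforce simp: solvable_def)
next
  assume "k \<in> I \<and> (\<exists>B \<pi> \<alpha>. upper_lp I R a p t e k B \<pi> \<alpha>)"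
  then show "k \<in> solvable I a t e"
    using upper_lp_bounds[OF assms(1)] unfolding solvable_def by fastforce
qed

text \<open>After subtracting \<open>d\<close>, each term of \<open>B_min\<close> is constant or
  decreasing in \<open>d\<close>, so the largest deviation gives the least value.\<close>

lemma lp_value_lower:
  assumes "finite I" "k \<in> I" "upper_lp I R a p t e k B \<pi> \<alpha>"
  shows "lp_value I a p t e k \<le> B - (t k + e - \<alpha> k)"
proof -
  have "I \<noteq> {}" using assms by auto
  from upper_lp_bounds[OF assms(1) this assms(2,3)] show ?thesis
    by (auto simp: lp_value_eq B_min_def)
qed

text \<open>This freedom in \<open>d\<close> lets the optimal solutions be chosen to suit the
  selection rule.\<close>

lemma upper_lp_optimum:
  assumes "finite I" "0 \<le> e" "reflp R" "transp R"
    and "\<And>i j. i \<in> I \<Longrightarrow> j \<in> I \<Longrightarrow> R i j \<Longrightarrow> a i \<le> a j \<and> p i \<le> p j \<and> t i \<le> t j"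
    and k: "k \<in> solvable I a t e"
    and d: "dist_min I a p t e k \<le> d" "d \<le> dist_max a t e k"
  shows "\<exists>B \<pi> \<alpha>. upper_lp I R a p t e k B \<pi> \<alpha> \<and> t k + e - \<alpha> k = d \<and> B - d = lp_value I a p t e k"
proof -
  have kI: "k \<in> I" using k by (simp add: solvable_def)
  have ex: "excess I a t \<le> d" using d(1) by (simp add: dist_min_def)
  obtain \<pi> \<alpha> where *: "upper_lp I R a p t e k (B_min I a p t e k d) \<pi> \<alpha>" "t k + e - \<alpha> k = d"
    using upper_lp_exists[OF assms(1) kI assms(2-5) ex d(2)] by blast
  have "B_min I a p t e k d - d \<le> lp_value I a p t e k"
    using d(1) lp_value_ge(2)[where I = I and a = a and p = p and t = t and e = e and k = k] by (auto simp: B_min_def dist_min_def field_simps)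
  moreover have "lp_value I a p t e k \<le> B_min I a p t e k d - d"
    using lp_value_lower[OF assms(1) kI *(1)] *(2) by simp
  ultimately show ?thesis using * by (intro exI[of _ "B_min I a p t e k d"] exI[of _ \<pi>] exI[of _ \<alpha>]) auto
qed


text \<open>Carries a point of the distance problem to a program: \<open>k\<close> maximises
  \<open>t i - \<alpha> i\<close>, so its deviation dominates the one at \<open>m\<close>, and
  \<open>\<alpha> m \<le> y\<close> makes it nonnegative. The number \<open>y\<close> will be
  \<open>\<tau> m\<close>, or \<open>- \<tau> m\<close> after reflection.\<close>

lemma upper_lp_at_max:
  assumes I: "finite I" "m \<in> I"
    and b: "\<And>i. i \<in> I \<Longrightarrow> p i \<le> \<pi> i \<and> \<pi> i \<le> p i + e \<and> a i \<le> \<alpha> i \<and> \<alpha> i \<le> a i + e \<and> \<bar>\<pi> i - \<alpha> i\<bar> \<le> B"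
    and mono: "\<And>i j. i \<in> I \<Longrightarrow> j \<in> I \<Longrightarrow> R i j \<Longrightarrow> \<pi> i \<le> \<pi> j \<and> \<alpha> i \<le> \<alpha> j"
    and y: "\<alpha> m \<le> y" "y \<le> t m + e"
  shows "\<exists>k\<in>I. upper_lp I R a p t e k B \<pi> \<alpha> \<and> y - \<alpha> m \<le> t k + e - \<alpha> k"
proof -
  have "I \<noteq> {}" using I by auto
  then obtain k where k: "k \<in> I" "\<And>i. i \<in> I \<Longrightarrow> t i - \<alpha> i \<le> t k - \<alpha> k"
    using arg_min_if_finite[OF I(1), of "\<lambda>i. \<alpha> i - t i"] by (smt (verit, best))
  show ?thesis
    using k k(2)[OF I(2)] b mono y by (intro bexI[of _ k]) (auto simp: upper_lp_def)
qed

section \<open>The two families as instances of the common form\<close>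

lemma consecutive_mono:
  fixes f :: "nat \<Rightarrow> real"
  assumes "\<forall>i\<in>{1..C-2}. f i \<le> f (i + 1)" "1 \<le> i" "i \<le> j" "j \<le> C - 1"
  shows "f i \<le> f j"
  using assms(3,4)
proof (induction j rule: dec_induct)
  case (step n)
  then have "n \<in> {1..C-2}" using assms(2) by auto
  then show ?case using step assms(1) by fastforce
qed simp

lemma consecutive_mono_iff:
  fixes f :: "nat \<Rightarrow> real"
  shows "(\<forall>i\<in>{1..C-2}. f i \<le> f (i + 1)) \<longleftrightarrow> (\<forall>i\<in>{1..C-1}. \<forall>j\<in>{1..C-1}. i \<le> j \<longrightarrow> f i \<le> f j)"
  using consecutive_mono[of C f] by (auto 0 3)

lemma L1_feasible_iff:
  assumes "\<And>i. \<pi>U i = \<pi>L i + e" "\<And>i. \<tau>U i = \<tau>L i + e" "\<And>i. \<alpha>U i = \<alpha>L i + e"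
  shows "L1_feasible C \<pi>L \<pi>U \<tau>U \<alpha>L \<alpha>U k (B, \<pi>, \<alpha>) \<longleftrightarrow>
    upper_lp {1..C-1} (\<le>) \<alpha>L \<pi>L \<tau>L e k B \<pi> \<alpha>"
proof -
  have "(\<forall>i\<in>{1..C-2}. \<pi> i \<le> \<pi> (i+1) \<and> \<alpha> i \<le> \<alpha> (i+1)) \<longleftrightarrow>
     (\<forall>i\<in>{1..C-1}. \<forall>j\<in>{1..C-1}. i \<le> j \<longrightarrow> \<pi> i \<le> \<pi> j \<and> \<alpha> i \<le> \<alpha> j)"
    using consecutive_mono_iff[of C \<pi>] consecutive_mono_iff[of C \<alpha>] by blast
  then show ?thesis
    unfolding L1_feasible.simps common_constraints.simps upper_lp_def in_bounds_def abs_le_iff assms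
    by (auto simp: algebra_simps)
qed

text \<open>Negating the variables reverses the order of the classes. The upper end of the negated
  \<tau> band is \<open>- \<tau>L k\<close>, so \<open>\<alpha> k - \<tau>L k\<close> becomes the
  deviation of the common form.\<close>

lemma L2_feasible_iff:
  assumes "\<And>i. \<pi>U i = \<pi>L i + e" "\<And>i. \<tau>U i = \<tau>L i + e" "\<And>i. \<alpha>U i = \<alpha>L i + e"
  shows "L2_feasible C \<pi>L \<pi>U \<tau>L \<alpha>L \<alpha>U k (B, \<pi>, \<alpha>) \<longleftrightarrow>
    upper_lp {1..C-1} (\<ge>) (reflect e \<alpha>L) (reflect e \<pi>L) (reflect e \<tau>L) e k B (\<lambda>i. - \<pi> i) (\<lambda>i. - \<alpha> i)"
proof -
  have "(\<forall>i\<in>{1..C-2}. \<pi> i \<le> \<pi> (i+1) \<and> \<alpha> i \<le> \<alpha> (i+1)) \<longleftrightarrow>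
     (\<forall>i\<in>{1..C-1}. \<forall>j\<in>{1..C-1}. j \<le> i \<longrightarrow> - \<pi> i \<le> - \<pi> j \<and> - \<alpha> i \<le> - \<alpha> j)"
    using consecutive_mono_iff[of C \<pi>] consecutive_mono_iff[of C \<alpha>] by auto
  then show ?thesis
    unfolding L2_feasible.simps common_constraints.simps upper_lp_def in_bounds_def abs_le_iff assms
      reflect_def
    by (auto simp: algebra_simps)
qed

section \<open>The Kolmogorov-Smirnov problem against the linear programs\<close>

lemma D_KS_ge: "i \<in> {1..C-1} \<Longrightarrow> \<bar>F i - G i\<bar> \<le> D_KS C F G"
  unfolding D_KS_def by (intro Max_ge) auto

lemma D_KS_le:
  assumes "C \<ge> 2" "\<And>i. i \<in> {1..C-1} \<Longrightarrow> \<bar>F i - G i\<bar> \<le> B"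
  shows "D_KS C F G \<le> B"
  unfolding D_KS_def using assms by (subst Max_le_iff) auto

lemma D_KS_obtain:
  assumes "C \<ge> 2"
  obtains m where "m \<in> {1..C-1}" "D_KS C F G = \<bar>F m - G m\<bar>"
proof -
  have "D_KS C F G \<in> (\<lambda>i. \<bar>F i - G i\<bar>) ` {1..C-1}"
    unfolding D_KS_def using assms by (intro Max_in) auto
  then show ?thesis using that by auto
qed

text \<open>The linear programs leave the entry \<open>C\<close> free, while cumulative distributions have the value 1 there.\<close>

definition extend_cum :: "nat \<Rightarrow> (nat \<Rightarrow> real) \<Rightarrow> nat \<Rightarrow> real" where
  "extend_cum C f i = (if i < C then f i else 1)"

lemma extend_cum_eq: "i \<in> {1..C-1} \<Longrightarrow> extend_cum C f i = f i"
  by (auto simp: extend_cum_def)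

lemma cumulative_extend_cum:
  assumes "C \<ge> 2" "\<And>i. i \<in> {1..C-1} \<Longrightarrow> 0 \<le> f i \<and> f i \<le> 1"
    and "\<And>i j. i \<in> {1..C-1} \<Longrightarrow> j \<in> {1..C-1} \<Longrightarrow> i \<le> j \<Longrightarrow> f i \<le> f j"
  shows "cumulative C (extend_cum C f)"
  unfolding cumulative_def using assms by (auto simp: extend_cum_def mono_on_def)

text \<open>\<open>B\<close> bounds the first distance from above, and index \<open>k\<close> bounds
  the second from below. The bounds in \<open>unit\<close> make the value 1 at the entry
  \<open>C\<close> compatible with monotonicity.\<close>

lemma KS_attain:
  assumes C: "C \<ge> 2" and F: "common_constraints C \<pi>L \<pi>U \<alpha>L \<alpha>U (B, \<pi>, \<alpha>)" and k: "k \<in> {1..C-1}"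
    and unit: "\<And>i. i \<in> {1..C-1} \<Longrightarrow> 0 \<le> \<pi>L i \<and> \<pi>U i \<le> 1 \<and> 0 \<le> \<alpha>L i \<and> \<alpha>U i \<le> 1 \<and> 0 \<le> \<tau>L i \<and> \<tau>U i \<le> 1"
    and \<tau>: "in_bounds C \<tau>L \<tau>U \<tau>"
      "\<And>i j. i \<in> {1..C-1} \<Longrightarrow> j \<in> {1..C-1} \<Longrightarrow> i \<le> j \<Longrightarrow> \<tau> i \<le> \<tau> j"
  shows "\<exists>s. KS_feasible C \<pi>L \<pi>U \<tau>L \<tau>U \<alpha>L \<alpha>U s \<and> KS_diff C s \<le> B - \<bar>\<tau> k - \<alpha> k\<bar>"
proof -
  let ?e = "extend_cum C"
  have bounds: "in_bounds C \<pi>L \<pi>U \<pi>" "in_bounds C \<alpha>L \<alpha>U \<alpha>"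
    using F by auto
  have B: "\<bar>\<pi> i - \<alpha> i\<bar> \<le> B" if "i \<in> {1..C-1}" for i
    using F that by (auto simp: abs_le_iff)
  have mono: "\<pi> i \<le> \<pi> j" "\<alpha> i \<le> \<alpha> j" if "i \<in> {1..C-1}" "j \<in> {1..C-1}" "i \<le> j" for i j
  proof -
    have "\<forall>i\<in>{1..C-2}. \<pi> i \<le> \<pi> (i+1)" "\<forall>i\<in>{1..C-2}. \<alpha> i \<le> \<alpha> (i+1)"
      using F unfolding common_constraints.simps by blast+
    then show "\<pi> i \<le> \<pi> j" "\<alpha> i \<le> \<alpha> j"
      using consecutive_mono[of C _ i j] that by auto
  qed
  have unit': "0 \<le> \<pi> i \<and> \<pi> i \<le> 1" "0 \<le> \<alpha> i \<and> \<alpha> i \<le> 1" "0 \<le> \<tau> i \<and> \<tau> i \<le> 1" if "i \<in> {1..C-1}" for i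
  proof -
    have "\<pi>L i \<le> \<pi> i" "\<pi> i \<le> \<pi>U i" "\<alpha>L i \<le> \<alpha> i" "\<alpha> i \<le> \<alpha>U i" "\<tau>L i \<le> \<tau> i" "\<tau> i \<le> \<tau>U i"
      using bounds \<tau>(1) that unfolding in_bounds_def by blast+
    with unit[OF that] show "0 \<le> \<pi> i \<and> \<pi> i \<le> 1" "0 \<le> \<alpha> i \<and> \<alpha> i \<le> 1" "0 \<le> \<tau> i \<and> \<tau> i \<le> 1"
      by linarith+
  qed
  have cum: "cumulative C (?e \<pi>)" "cumulative C (?e \<alpha>)" "cumulative C (?e \<tau>)"
    by (rule cumulative_extend_cum[OF C]; use unit' mono \<tau>(2) in blast)+
  have "KS_feasible C \<pi>L \<pi>U \<tau>L \<tau>U \<alpha>L \<alpha>U (?e \<pi>, ?e \<tau>, ?e \<alpha>)"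
    using cum bounds \<tau>(1) by (simp add: in_bounds_def extend_cum_eq)
  moreover have "KS_diff C (?e \<pi>, ?e \<tau>, ?e \<alpha>) \<le> B - \<bar>\<tau> k - \<alpha> k\<bar>"
    using D_KS_le[OF C, of "?e \<pi>" "?e \<alpha>" B] B D_KS_ge[OF k, of "?e \<tau>" "?e \<alpha>"] k
    by (force simp: extend_cum_eq)
  ultimately show ?thesis by blast
qed

text \<open>Take \<open>B\<close> to be the first distance and \<open>m\<close> an index attaining
  the second. The sign of \<open>\<tau> m - \<alpha> m\<close> decides which family supplies the
  program.\<close>

lemma KS_lower:
  assumes C: "C \<ge> 2" and s: "KS_feasible C \<pi>L \<pi>U \<tau>L \<tau>U \<alpha>L \<alpha>U (\<pi>, \<tau>, \<alpha>)"
    and U: "\<And>i. \<pi>U i = \<pi>L i + e" "\<And>i. \<tau>U i = \<tau>L i + e" "\<And>i. \<alpha>U i = \<alpha>L i + e"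
  shows "\<exists>k\<in>{1..C-1}. \<exists>B P Q.
     upper_lp {1..C-1} (\<le>) \<alpha>L \<pi>L \<tau>L e k B P Q \<and>
       B - (\<tau>L k + e - Q k) \<le> KS_diff C (\<pi>, \<tau>, \<alpha>) \<or>
     upper_lp {1..C-1} (\<ge>) (reflect e \<alpha>L) (reflect e \<pi>L) (reflect e \<tau>L) e k B P Q \<and>
       B - (reflect e \<tau>L k + e - Q k) \<le> KS_diff C (\<pi>, \<tau>, \<alpha>)"
proof -
  let ?I = "{1..C-1}" and ?B = "D_KS C \<pi> \<alpha>"
  have b: "\<pi>L i \<le> \<pi> i \<and> \<pi> i \<le> \<pi>L i + e \<and> \<alpha>L i \<le> \<alpha> i \<and> \<alpha> i \<le> \<alpha>L i + e \<and> \<tau>L i \<le> \<tau> i \<and> \<tau> i \<le> \<tau>L i + e \<and> \<bar>\<pi> i - \<alpha> i\<bar> \<le> ?B"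
    if "i \<in> ?I" for i
    using s that D_KS_ge[OF that, of \<pi> \<alpha>] by (auto simp: in_bounds_def U)
  have mono: "\<pi> i \<le> \<pi> j \<and> \<alpha> i \<le> \<alpha> j" if "i \<in> ?I" "j \<in> ?I" "i \<le> j" for i j
  proof -
    have "i \<in> {1..C}" "j \<in> {1..C}" using that by auto
    then show ?thesis using s that(3) unfolding KS_feasible.simps cumulative_def by (blast dest: mono_onD)
  qed
  obtain m where m: "m \<in> ?I" "D_KS C \<tau> \<alpha> = \<bar>\<tau> m - \<alpha> m\<bar>" by (rule D_KS_obtain[OF C])
  show ?thesis
  proof (cases "\<alpha> m \<le> \<tau> m")
    case True
    have "\<exists>k\<in>?I. upper_lp ?I (\<le>) \<alpha>L \<pi>L \<tau>L e k ?B \<pi> \<alpha> \<and> \<tau> m - \<alpha> m \<le> \<tau>L k + e - \<alpha> k"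
      by (rule upper_lp_at_max) (use m b mono True in auto)
    then show ?thesis using m True by force
  next
    case False
    have b': "reflect e \<pi>L i \<le> - \<pi> i \<and> - \<pi> i \<le> reflect e \<pi>L i + e \<and> reflect e \<alpha>L i \<le> - \<alpha> i \<and>
        - \<alpha> i \<le> reflect e \<alpha>L i + e \<and> \<bar>- \<pi> i - - \<alpha> i\<bar> \<le> ?B" if "i \<in> ?I" for i
      using b[OF that] unfolding reflect_def by linarith
    have "\<exists>k\<in>?I. upper_lp ?I (\<ge>) (reflect e \<alpha>L) (reflect e \<pi>L) (reflect e \<tau>L) e k ?B (\<lambda>i. - \<pi> i) (\<lambda>i. - \<alpha> i) \<and>
        - \<tau> m - - \<alpha> m \<le> reflect e \<tau>L k + e - - \<alpha> k"
      by (rule upper_lp_at_max) (use m b[OF m(1)] b' mono False in \<open>auto simp: reflect_def\<close>)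
    then obtain k where "k \<in> ?I"
      "upper_lp ?I (\<ge>) (reflect e \<alpha>L) (reflect e \<pi>L) (reflect e \<tau>L) e k ?B (\<lambda>i. - \<pi> i) (\<lambda>i. - \<alpha> i)"
      "- \<tau> m - - \<alpha> m \<le> reflect e \<tau>L k + e - - \<alpha> k" by blast
    then show ?thesis using m False
      by (intro bexI[of _ k] exI[of _ ?B] exI[of _ "\<lambda>i. - \<pi> i"] exI[of _ "\<lambda>i. - \<alpha> i"] disjI2) auto
  qed
qed

section \<open>The selection rule\<close>

text \<open>The selected index has the largest deviation over both families, so nothing beats it
  strictly and it must have value \<open>L\<close>. Strictness covers every choice among tied
  maximisers.\<close>

lemma selection_yieldsI:
  assumes ne: "K1 \<union> K2 \<noteq> {}"
    and 1: "\<And>y. y \<in> K1 \<Longrightarrow> v1 y \<noteq> L \<Longrightarrow> (\<exists>x\<in>K1. v1 x = L \<and> d1 y < d1 x) \<or> (\<exists>x\<in>K2. v2 x = L \<and> d1 y < d2 x)"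
    and 2: "\<And>y. y \<in> K2 \<Longrightarrow> v2 y \<noteq> L \<Longrightarrow> (\<exists>x\<in>K1. v1 x = L \<and> d2 y < d1 x) \<or> (\<exists>x\<in>K2. v2 x = L \<and> d2 y < d2 x)"
  shows "selection_yields K1 d1 v1 K2 d2 v2 (L :: real)"
  unfolding selection_yields_def
proof (intro conjI allI impI)
  fix k1 k2
  assume k1: "K1 \<noteq> {} \<longrightarrow> is_arg_max d1 (\<lambda>k. k \<in> K1) k1"
    and k2: "K2 \<noteq> {} \<longrightarrow> is_arg_max d2 (\<lambda>k. k \<in> K2) k2"
  have m1: "k1 \<in> K1 \<and> d1 x \<le> d1 k1" if "x \<in> K1" for x
    using k1 that by (force simp: is_arg_max_linorder)
  have m2: "k2 \<in> K2 \<and> d2 x \<le> d2 k2" if "x \<in> K2" for x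
    using k2 that by (force simp: is_arg_max_linorder)
  show "L = (if K2 = {} \<or> (K1 \<noteq> {} \<and> d1 k1 \<ge> d2 k2) then v1 k1 else v2 k2)"
  proof (cases "K2 = {} \<or> (K1 \<noteq> {} \<and> d1 k1 \<ge> d2 k2)")
    case True
    then have "k1 \<in> K1" using m1 ne by blast
    then show ?thesis using 1[of k1] m1 m2 True by force
  next
    case False
    then have "k2 \<in> K2" using m2 by blast
    have "v2 k2 = L"
    proof (rule ccontr)
      assume "v2 k2 \<noteq> L"
      from 2[OF \<open>k2 \<in> K2\<close> this] obtain x where "x \<in> K1 \<and> d2 k2 < d1 x \<or> x \<in> K2 \<and> d2 k2 < d2 x"
        by blast
      then show False using m1[of x] m2[of x] False by force
    qed
    then show ?thesis using False by argo
  qed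
qed (rule ne)

section \<open>Bounds of the contamination model and assembly of the result\<close>

lemma lower_cum_mono:
  assumes "\<epsilon> \<le> 1" "i \<le> j"
  shows "lower_cum \<epsilon> P i \<le> lower_cum \<epsilon> P j"
  unfolding lower_cum_def using assms
  by (intro mult_left_mono measure_pmf.finite_measure_mono) auto

lemma cum_unit:
  assumes "0 \<le> \<epsilon>" "\<epsilon> \<le> 1"
  shows "0 \<le> lower_cum \<epsilon> P i" "upper_cum \<epsilon> P i \<le> 1"
  using assms mult_left_mono[OF measure_pmf.prob_le_1, of "1 - \<epsilon>" P "{1..i}"]
  by (auto simp: lower_cum_def upper_cum_def)

lemma upper_cum_eq: "upper_cum \<epsilon> P i = lower_cum \<epsilon> P i + \<epsilon>"
  by (simp add: lower_cum_def upper_cum_def)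

theorem proposition2:
  fixes C :: nat and \<epsilon> :: real and P_S P_Si P_N :: "nat pmf"
    and \<pi>L \<pi>U \<tau>L \<tau>U \<alpha>L \<alpha>U :: "nat \<Rightarrow> real" and K1 K2 :: "nat set"
  assumes "C \<ge> 2" and "0 \<le> \<epsilon>" and "\<epsilon> \<le> 1"
    and "dist_on_classes C P_S" and "dist_on_classes C P_Si" and "dist_on_classes C P_N"
    and "\<pi>L = lower_cum \<epsilon> P_S" and "\<pi>U = upper_cum \<epsilon> P_S"
    and "\<tau>L = lower_cum \<epsilon> P_Si" and "\<tau>U = upper_cum \<epsilon> P_Si"
    and "\<alpha>L = lower_cum \<epsilon> P_N" and "\<alpha>U = upper_cum \<epsilon> P_N"
    and "K1 = {k \<in> {1..C-1}. \<exists>x. L1_feasible C \<pi>L \<pi>U \<tau>U \<alpha>L \<alpha>U k x}"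
    and "K2 = {k \<in> {1..C-1}. \<exists>x. L2_feasible C \<pi>L \<pi>U \<tau>L \<alpha>L \<alpha>U k x}"
  shows "\<exists>s B1 \<pi>1 \<alpha>1 B2 \<pi>2 \<alpha>2.
      is_arg_min (KS_diff C) (KS_feasible C \<pi>L \<pi>U \<tau>L \<tau>U \<alpha>L \<alpha>U) s \<and>
      (\<forall>k\<in>K1. is_arg_min (L1_obj \<tau>U k) (L1_feasible C \<pi>L \<pi>U \<tau>U \<alpha>L \<alpha>U k) (B1 k, \<pi>1 k, \<alpha>1 k)) \<and>
      (\<forall>k\<in>K2. is_arg_min (L2_obj \<tau>L k) (L2_feasible C \<pi>L \<pi>U \<tau>L \<alpha>L \<alpha>U k) (B2 k, \<pi>2 k, \<alpha>2 k)) \<and>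
      selection_yields
        K1 (\<lambda>k. \<tau>U k - \<alpha>1 k k) (\<lambda>k. L1_obj \<tau>U k (B1 k, \<pi>1 k, \<alpha>1 k))
        K2 (\<lambda>k. \<alpha>2 k k - \<tau>L k) (\<lambda>k. L2_obj \<tau>L k (B2 k, \<pi>2 k, \<alpha>2 k))
        (KS_diff C s)"
proof -
  let ?I = "{1..C-1}"
  let ?a = "reflect \<epsilon> \<alpha>L" and ?p = "reflect \<epsilon> \<pi>L" and ?t = "reflect \<epsilon> \<tau>L"
  note eps = assms(2,3)
  \<comment> \<open>All three bands have the same width \<epsilon>, which the common form of the
    programs presupposes.\<close>
  have U: "\<And>i. \<pi>U i = \<pi>L i + \<epsilon>" "\<And>i. \<tau>U i = \<tau>L i + \<epsilon>" "\<And>i. \<alpha>U i = \<alpha>L i + \<epsilon>"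
    unfolding assms(7-12) by (simp_all add: upper_cum_eq)
  have unit: "0 \<le> \<pi>L i \<and> \<pi>U i \<le> 1 \<and> 0 \<le> \<alpha>L i \<and> \<alpha>U i \<le> 1 \<and> 0 \<le> \<tau>L i \<and> \<tau>U i \<le> 1" for i
    unfolding assms(7-12) using cum_unit[OF eps] by simp
  have mono: "\<alpha>L i \<le> \<alpha>L j \<and> \<pi>L i \<le> \<pi>L j \<and> \<tau>L i \<le> \<tau>L j" if "i \<le> j" for i j
    unfolding assms(7-12) using lower_cum_mono[OF eps(2) that] by simp
  have mono': "?a i \<le> ?a j \<and> ?p i \<le> ?p j \<and> ?t i \<le> ?t j" if "i \<ge> j" for i j
    using mono[OF that] by (simp add: reflect_def)
  have order: "reflp ((\<le>) :: nat \<Rightarrow> _)" "transp ((\<le>) :: nat \<Rightarrow> _)"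
    "reflp ((\<ge>) :: nat \<Rightarrow> _)" "transp ((\<ge>) :: nat \<Rightarrow> _)"
    by (auto simp: reflp_def transp_def)
  have fin: "finite ?I" "?I \<noteq> {}" using assms(1) by auto
  note feas1 = L1_feasible_iff[of \<pi>U \<pi>L \<epsilon> \<tau>U \<tau>L \<alpha>U \<alpha>L, OF U]
  note feas2 = L2_feasible_iff[of \<pi>U \<pi>L \<epsilon> \<tau>U \<tau>L \<alpha>U \<alpha>L, OF U]
  note solv1 = upper_lp_solvable_iff[OF fin(1) eps(1) order(1,2), of \<alpha>L \<pi>L \<tau>L, OF mono]
  note solv2 = upper_lp_solvable_iff[OF fin(1) eps(1) order(3,4), of ?a ?p ?t, OF mono']
  \<comment> \<open>Lets an arbitrary feasible point of the reflected program be written as a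
    negated pair, as \<open>feas2\<close> expects.\<close>
  have minus: "\<exists>g. f = (\<lambda>i. - g i)" for f :: "nat \<Rightarrow> real"
    by (rule exI[of _ "\<lambda>i. - f i"]) simp
  have K1: "K1 = solvable ?I \<alpha>L \<tau>L \<epsilon>"
  proof -
    have "(\<exists>x. L1_feasible C \<pi>L \<pi>U \<tau>U \<alpha>L \<alpha>U k x) \<longleftrightarrow> (\<exists>B P Q. upper_lp ?I (\<le>) \<alpha>L \<pi>L \<tau>L \<epsilon> k B P Q)" for k
      using feas1 by (metis prod_cases3)
    then show ?thesis unfolding assms(13) using solv1 by blast
  qed
  have K2: "K2 = solvable ?I ?a ?t \<epsilon>"
  proof -
    have "(\<exists>x. L2_feasible C \<pi>L \<pi>U \<tau>L \<alpha>L \<alpha>U k x) \<longleftrightarrow> (\<exists>B P Q. upper_lp ?I (\<ge>) ?a ?p ?t \<epsilon> k B P Q)" for k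
      using feas2 minus by (metis prod_cases3)
    then show ?thesis unfolding assms(14) using solv2 by blast
  qed
  define v1 where "v1 = lp_value ?I \<alpha>L \<pi>L \<tau>L \<epsilon>"
  define v2 where "v2 = lp_value ?I ?a ?p ?t \<epsilon>"
  define L where "L = Min (v1 ` K1 \<union> v2 ` K2)"
  \<comment> \<open>The deviations prescribed for the optimal solutions: largest where the value is
    \<open>L\<close>, smallest elsewhere.\<close>
  define d1 where "d1 k = (if v1 k = L then dist_max \<alpha>L \<tau>L \<epsilon> k else dist_min ?I \<alpha>L \<pi>L \<tau>L \<epsilon> k)" for k
  define d2 where "d2 k = (if v2 k = L then dist_max ?a ?t \<epsilon> k else dist_min ?I ?a ?p ?t \<epsilon> k)" for k

  have KS_bound: "(\<exists>k\<in>K1. v1 k \<le> KS_diff C s) \<or> (\<exists>k\<in>K2. v2 k \<le> KS_diff C s)"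
    if s: "KS_feasible C \<pi>L \<pi>U \<tau>L \<tau>U \<alpha>L \<alpha>U s" for s
  proof -
    obtain \<pi> \<tau> \<alpha> where s_eq: "s = (\<pi>, \<tau>, \<alpha>)" by (cases s)
    obtain k B P Q where k: "k \<in> ?I" and
      "upper_lp ?I (\<le>) \<alpha>L \<pi>L \<tau>L \<epsilon> k B P Q \<and> B - (\<tau>L k + \<epsilon> - Q k) \<le> KS_diff C s \<or>
       upper_lp ?I (\<ge>) ?a ?p ?t \<epsilon> k B P Q \<and> B - (?t k + \<epsilon> - Q k) \<le> KS_diff C s"
      using KS_lower[OF assms(1) s[unfolded s_eq], of \<epsilon>, OF U] unfolding s_eq by blast
    then consider "upper_lp ?I (\<le>) \<alpha>L \<pi>L \<tau>L \<epsilon> k B P Q" "B - (\<tau>L k + \<epsilon> - Q k) \<le> KS_diff C s"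
      | "upper_lp ?I (\<ge>) ?a ?p ?t \<epsilon> k B P Q" "B - (?t k + \<epsilon> - Q k) \<le> KS_diff C s" by blast
    then show ?thesis
    proof cases
      case 1
      moreover have "k \<in> K1" unfolding K1 using solv1 k 1 by blast
      moreover have "v1 k \<le> B - (\<tau>L k + \<epsilon> - Q k)"
        unfolding v1_def using lp_value_lower[OF fin(1) k 1(1)] .
      ultimately show ?thesis by (meson order_trans)
    next
      case 2
      moreover have "k \<in> K2" unfolding K2 using solv2 k 2 by blast
      moreover have "v2 k \<le> B - (?t k + \<epsilon> - Q k)"
        unfolding v2_def using lp_value_lower[OF fin(1) k 2(1)] .
      ultimately show ?thesis by (meson order_trans)
    qed
  qed

  \<comment> \<open>A feasible triple, by \<open>KS_bound\<close>, forces at least one program to be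
    solvable.\<close>
  have "KS_feasible C \<pi>L \<pi>U \<tau>L \<tau>U \<alpha>L \<alpha>U (extend_cum C \<pi>L, extend_cum C \<tau>L, extend_cum C \<alpha>L)"
    using unit mono U eps
    by (auto simp: in_bounds_def extend_cum_eq intro!: cumulative_extend_cum[OF assms(1)])
      (smt (verit) unit U)+
  then have ne: "K1 \<union> K2 \<noteq> {}" using KS_bound by blast
  have "finite K1" "finite K2" unfolding assms(13,14) by auto
  then have L_le: "\<And>k. k \<in> K1 \<Longrightarrow> L \<le> v1 k" "\<And>k. k \<in> K2 \<Longrightarrow> L \<le> v2 k"
    by (auto simp: L_def)
  have "L \<in> v1 ` K1 \<union> v2 ` K2"
    unfolding L_def using \<open>finite K1\<close> \<open>finite K2\<close> ne by (intro Min_in) auto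
  then have L_att: "(\<exists>k\<in>K1. v1 k = L) \<or> (\<exists>k\<in>K2. v2 k = L)" by auto

  have "\<exists>B \<pi> \<alpha>. is_arg_min (L1_obj \<tau>U k) (L1_feasible C \<pi>L \<pi>U \<tau>U \<alpha>L \<alpha>U k) (B, \<pi>, \<alpha>) \<and>
      \<tau>U k - \<alpha> k = d1 k \<and> L1_obj \<tau>U k (B, \<pi>, \<alpha>) = v1 k" if k: "k \<in> K1" for k
  proof -
    have kI: "k \<in> ?I" using k assms(13) by simp
    have d: "dist_min ?I \<alpha>L \<pi>L \<tau>L \<epsilon> k \<le> d1 k" "d1 k \<le> dist_max \<alpha>L \<tau>L \<epsilon> k"
      using dist_min_le_dist_max[OF k[unfolded K1], of \<pi>L] by (simp_all add: d1_def)
    then obtain B \<pi> \<alpha> where *: "upper_lp ?I (\<le>) \<alpha>L \<pi>L \<tau>L \<epsilon> k B \<pi> \<alpha>" "\<tau>L k + \<epsilon> - \<alpha> k = d1 k" "B - d1 k = v1 k"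
      using upper_lp_optimum[OF fin(1) eps(1) order(1,2), of \<alpha>L \<pi>L \<tau>L, OF mono k[unfolded K1] d]
      unfolding v1_def by blast
    have "v1 k \<le> L1_obj \<tau>U k x" if x: "L1_feasible C \<pi>L \<pi>U \<tau>U \<alpha>L \<alpha>U k x" for x
    proof -
      obtain B' P Q where x_eq: "x = (B', P, Q)" by (cases x)
      have "upper_lp ?I (\<le>) \<alpha>L \<pi>L \<tau>L \<epsilon> k B' P Q" using x by (simp only: x_eq feas1)
      from lp_value_lower[OF fin(1) kI this] show ?thesis by (simp add: x_eq v1_def U)
    qed
    moreover have "L1_feasible C \<pi>L \<pi>U \<tau>U \<alpha>L \<alpha>U k (B, \<pi>, \<alpha>)" using *(1) by (simp only: feas1)
    moreover have "L1_obj \<tau>U k (B, \<pi>, \<alpha>) = v1 k" using *(2,3) by (simp add: U)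
    ultimately show ?thesis using *(2)
      by (intro exI[of _ B] exI[of _ \<pi>] exI[of _ \<alpha>])
        (simp add: is_arg_min_linorder U del: L1_feasible.simps L1_obj.simps)
  qed
  then obtain B1 \<pi>1 \<alpha>1 where opt1: "\<And>k. k \<in> K1 \<Longrightarrow>
      is_arg_min (L1_obj \<tau>U k) (L1_feasible C \<pi>L \<pi>U \<tau>U \<alpha>L \<alpha>U k) (B1 k, \<pi>1 k, \<alpha>1 k) \<and>
      \<tau>U k - \<alpha>1 k k = d1 k \<and> L1_obj \<tau>U k (B1 k, \<pi>1 k, \<alpha>1 k) = v1 k"
    by metis

  have "\<exists>B \<pi> \<alpha>. is_arg_min (L2_obj \<tau>L k) (L2_feasible C \<pi>L \<pi>U \<tau>L \<alpha>L \<alpha>U k) (B, \<pi>, \<alpha>) \<and>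
      \<alpha> k - \<tau>L k = d2 k \<and> L2_obj \<tau>L k (B, \<pi>, \<alpha>) = v2 k" if k: "k \<in> K2" for k
  proof -
    have kI: "k \<in> ?I" using k assms(14) by simp
    have d: "dist_min ?I ?a ?p ?t \<epsilon> k \<le> d2 k" "d2 k \<le> dist_max ?a ?t \<epsilon> k"
      using dist_min_le_dist_max[OF k[unfolded K2], of ?p] by (simp_all add: d2_def)
    then obtain B P Q where *: "upper_lp ?I (\<ge>) ?a ?p ?t \<epsilon> k B P Q" "?t k + \<epsilon> - Q k = d2 k" "B - d2 k = v2 k"
      using upper_lp_optimum[OF fin(1) eps(1) order(3,4), of ?a ?p ?t, OF mono' k[unfolded K2] d]
      unfolding v2_def by blast
    have "v2 k \<le> L2_obj \<tau>L k x" if x: "L2_feasible C \<pi>L \<pi>U \<tau>L \<alpha>L \<alpha>U k x" for x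
    proof -
      obtain B' P Q where x_eq: "x = (B', P, Q)" by (cases x)
      have "upper_lp ?I (\<ge>) ?a ?p ?t \<epsilon> k B' (\<lambda>i. - P i) (\<lambda>i. - Q i)" using x by (simp only: x_eq feas2)
      from lp_value_lower[OF fin(1) kI this] show ?thesis by (simp add: x_eq v2_def reflect_def)
    qed
    moreover have "L2_feasible C \<pi>L \<pi>U \<tau>L \<alpha>L \<alpha>U k (B, \<lambda>i. - P i, \<lambda>i. - Q i)"
      using *(1) by (simp only: feas2 minus_minus)
    moreover have "L2_obj \<tau>L k (B, \<lambda>i. - P i, \<lambda>i. - Q i) = v2 k" using *(2,3) by (simp add: reflect_def)
    ultimately show ?thesis using *(2)
      by (intro exI[of _ B] exI[of _ "\<lambda>i. - P i"] exI[of _ "\<lambda>i. - Q i"])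
        (simp add: is_arg_min_linorder reflect_def del: L2_feasible.simps L2_obj.simps)
  qed
  then obtain B2 \<pi>2 \<alpha>2 where opt2: "\<And>k. k \<in> K2 \<Longrightarrow>
      is_arg_min (L2_obj \<tau>L k) (L2_feasible C \<pi>L \<pi>U \<tau>L \<alpha>L \<alpha>U k) (B2 k, \<pi>2 k, \<alpha>2 k) \<and>
      \<alpha>2 k k - \<tau>L k = d2 k \<and> L2_obj \<tau>L k (B2 k, \<pi>2 k, \<alpha>2 k) = v2 k"
    by metis

  have "\<exists>s. KS_feasible C \<pi>L \<pi>U \<tau>L \<tau>U \<alpha>L \<alpha>U s \<and> KS_diff C s \<le> L"
    using L_att
  proof (elim disjE bexE)
    fix k assume k: "k \<in> K1" "v1 k = L"
    have F: "L1_feasible C \<pi>L \<pi>U \<tau>U \<alpha>L \<alpha>U k (B1 k, \<pi>1 k, \<alpha>1 k)"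
      using opt1[OF k(1)] unfolding is_arg_min_def by blast
    have v: "B1 k - (\<tau>U k - \<alpha>1 k k) = L" using opt1[OF k(1)] k(2) by simp
    have cc: "common_constraints C \<pi>L \<pi>U \<alpha>L \<alpha>U (B1 k, \<pi>1 k, \<alpha>1 k)" and le: "\<alpha>1 k k \<le> \<tau>U k"
      using F by (simp_all only: L1_feasible.simps)
    have "k \<in> ?I" using k(1) by (simp add: assms(13))
    \<comment> \<open>Placing \<tau> at its upper bounds turns
      \<open>\<bar>\<tau> k - \<alpha>1 k k\<bar>\<close> into the deviation of the program, because
      \<open>\<alpha>1 k k \<le> \<tau>U k\<close>. The second family uses the lower bounds in the
      same way.\<close>
    moreover have "in_bounds C \<tau>L \<tau>U \<tau>U" using eps by (simp add: in_bounds_def U)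
    moreover have "\<tau>U i \<le> \<tau>U j" if "i \<le> j" for i j using mono[OF that] by (simp add: U)
    ultimately have "\<exists>s. KS_feasible C \<pi>L \<pi>U \<tau>L \<tau>U \<alpha>L \<alpha>U s \<and> KS_diff C s \<le> B1 k - \<bar>\<tau>U k - \<alpha>1 k k\<bar>"
      using KS_attain[OF assms(1) cc _ unit] by blast
    then show ?thesis using le v by simp
  next
    fix k assume k: "k \<in> K2" "v2 k = L"
    have F: "L2_feasible C \<pi>L \<pi>U \<tau>L \<alpha>L \<alpha>U k (B2 k, \<pi>2 k, \<alpha>2 k)"
      using opt2[OF k(1)] unfolding is_arg_min_def by blast
    have v: "B2 k - (\<alpha>2 k k - \<tau>L k) = L" using opt2[OF k(1)] k(2) by simp
    have cc: "common_constraints C \<pi>L \<pi>U \<alpha>L \<alpha>U (B2 k, \<pi>2 k, \<alpha>2 k)" and le: "\<alpha>2 k k \<ge> \<tau>L k"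
      using F by (simp_all only: L2_feasible.simps)
    have "k \<in> ?I" using k(1) by (simp add: assms(14))
    moreover have "in_bounds C \<tau>L \<tau>U \<tau>L" using eps by (simp add: in_bounds_def U)
    moreover have "\<tau>L i \<le> \<tau>L j" if "i \<le> j" for i j using mono[OF that] by (simp add: U)
    ultimately have "\<exists>s. KS_feasible C \<pi>L \<pi>U \<tau>L \<tau>U \<alpha>L \<alpha>U s \<and> KS_diff C s \<le> B2 k - \<bar>\<tau>L k - \<alpha>2 k k\<bar>"
      using KS_attain[OF assms(1) cc _ unit] by blast
    then show ?thesis using le v by simp
  qed
  then obtain s where s: "KS_feasible C \<pi>L \<pi>U \<tau>L \<tau>U \<alpha>L \<alpha>U s" "KS_diff C s \<le> L" by blast
  have L_bound: "L \<le> KS_diff C s'" if "KS_feasible C \<pi>L \<pi>U \<tau>L \<tau>U \<alpha>L \<alpha>U s'" for s'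
    using KS_bound[OF that] L_le by (meson order_trans)
  have s_L: "KS_diff C s = L" using L_bound[OF s(1)] s(2) by simp
  have s_min: "is_arg_min (KS_diff C) (KS_feasible C \<pi>L \<pi>U \<tau>L \<tau>U \<alpha>L \<alpha>U) s"
    using s(1) s_L L_bound by (simp add: is_arg_min_linorder)

  have sel: "selection_yields K1 (\<lambda>k. \<tau>U k - \<alpha>1 k k) (\<lambda>k. L1_obj \<tau>U k (B1 k, \<pi>1 k, \<alpha>1 k))
        K2 (\<lambda>k. \<alpha>2 k k - \<tau>L k) (\<lambda>k. L2_obj \<tau>L k (B2 k, \<pi>2 k, \<alpha>2 k)) L"
  proof (rule selection_yieldsI[OF ne])
    fix y assume y: "y \<in> K1" "L1_obj \<tau>U y (B1 y, \<pi>1 y, \<alpha>1 y) \<noteq> L"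
    then have "v1 y \<noteq> L" using opt1 by simp
    then have d: "L < v1 y" "d1 y = dist_min ?I \<alpha>L \<pi>L \<tau>L \<epsilon> y" using L_le y(1) by (force simp: d1_def)+
    have "(\<exists>x\<in>K1. v1 x = L \<and> d1 y < d1 x) \<or> (\<exists>x\<in>K2. v2 x = L \<and> d1 y < d2 x)"
      using optimal_dist[OF fin eps(1), of \<alpha>L \<tau>L L \<pi>L y] L_le L_att y(1) d
      unfolding K1 K2 v1_def v2_def d1_def d2_def by fastforce
    then show "(\<exists>x\<in>K1. L1_obj \<tau>U x (B1 x, \<pi>1 x, \<alpha>1 x) = L \<and> \<tau>U y - \<alpha>1 y y < \<tau>U x - \<alpha>1 x x) \<or>
       (\<exists>x\<in>K2. L2_obj \<tau>L x (B2 x, \<pi>2 x, \<alpha>2 x) = L \<and> \<tau>U y - \<alpha>1 y y < \<alpha>2 x x - \<tau>L x)"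
      using opt1 opt2 y(1) by (auto simp del: L1_obj.simps L2_obj.simps)
  next
    fix y assume y: "y \<in> K2" "L2_obj \<tau>L y (B2 y, \<pi>2 y, \<alpha>2 y) \<noteq> L"
    then have "v2 y \<noteq> L" using opt2 by simp
    then have d: "L < v2 y" "d2 y = dist_min ?I ?a ?p ?t \<epsilon> y" using L_le y(1) by (force simp: d2_def)+
    have "(\<exists>x\<in>K1. v1 x = L \<and> d2 y < d1 x) \<or> (\<exists>x\<in>K2. v2 x = L \<and> d2 y < d2 x)"
      using optimal_dist[OF fin eps(1), of ?a ?t L ?p y] L_le L_att y(1) d
      unfolding K1 K2 v1_def v2_def d1_def d2_def by fastforce
    then show "(\<exists>x\<in>K1. L1_obj \<tau>U x (B1 x, \<pi>1 x, \<alpha>1 x) = L \<and> \<alpha>2 y y - \<tau>L y < \<tau>U x - \<alpha>1 x x) \<or>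
       (\<exists>x\<in>K2. L2_obj \<tau>L x (B2 x, \<pi>2 x, \<alpha>2 x) = L \<and> \<alpha>2 y y - \<tau>L y < \<alpha>2 x x - \<tau>L x)"
      using opt1 opt2 y(1) by (auto simp del: L1_obj.simps L2_obj.simps)
  qed
  have min1: "\<forall>k\<in>K1. is_arg_min (L1_obj \<tau>U k) (L1_feasible C \<pi>L \<pi>U \<tau>U \<alpha>L \<alpha>U k) (B1 k, \<pi>1 k, \<alpha>1 k)"
    and min2: "\<forall>k\<in>K2. is_arg_min (L2_obj \<tau>L k) (L2_feasible C \<pi>L \<pi>U \<tau>L \<alpha>L \<alpha>U k) (B2 k, \<pi>2 k, \<alpha>2 k)"
    using opt1 opt2 by blast+
  show ?thesis
    by (intro exI) (rule conjI[OF s_min conjI[OF min1 conjI[OF min2 sel[folded s_L]]]])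
qed

end
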